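(* Let $V_{N,2N}(x) = 2\Delta_{2N}(x) - \Delta_N(x)$ be the de la Vallée Poussin kernel. Then for all integers $N \ge 1$, $$\int_0^1 |V_{N,2N}(x)|\,dx = L_1 = \frac{1}{3} + \frac{2\sqrt{3}}{\pi} = 1.43599112\ldots,$$ where $L_1$ is the first Lebesgue constant.
   Context: For an integer $m \ge 1$, $\Delta_m(x) = \frac{1}{m}\left(\frac{\sin \pi m x}{\sin \pi x}\right)^2$ is the Fejér kernel of period $1$ (extended by continuity to integer $x$). The $n$-th Lebesgue constant is $$L_n = \frac{1}{2\pi}\int_0^{2\pi} \left|\frac{\sin\left((n+\tfrac12)\theta\right)}{\sin(\theta/2)}\right| d\theta,$$ equivalently $L_n = \int_0^1 |D_n(x)|\,dx$ with $D_n(x) = \sum_{k=-n}^{n} e^{2\pi i k x}$ the Dirichlet kernel for functions of period $1$. *)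

theory Defs
  imports "HOL-Analysis.Analysis" "HOL-Real_Asymp.Real_Asymp"
begin

text \<open>At the integers the quotient has a removable singularity, with limit
  \<open>m\<^sup>2 / m = m\<close>; see \<open>isCont_fejer_kernel\<close> below.\<close>

definition fejer_kernel :: "nat \<Rightarrow> real \<Rightarrow> real" where
  "fejer_kernel m x =
     (if x \<in> \<int> then real m
      else 1 / real m * (sin (pi * real m * x) / sin (pi * x))\<^sup>2)"

definition vp_kernel :: "nat \<Rightarrow> real \<Rightarrow> real" where
  "vp_kernel N x = 2 * fejer_kernel (2 * N) x - fejer_kernel N x"

text \<open>At the end points \<open>0\<close> and \<open>2 * pi\<close> the integrand is \<open>0 / 0\<close> or \<open>x / 0\<close>, which is \<open>0\<close> here;
  this does not affect the integral.\<close>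

definition lebesgue_const :: "nat \<Rightarrow> real" where
  "lebesgue_const n =
     1 / (2 * pi) *
       integral {0..2 * pi} (\<lambda>\<theta>. \<bar>sin ((real n + 1 / 2) * \<theta>) / sin (\<theta> / 2)\<bar>)"

lemma sin_pi_eq_0_iff_Ints: "sin (pi * x) = 0 \<longleftrightarrow> x \<in> \<int>" for x :: real
proof -
  have "sin (pi * x) = 0 \<longleftrightarrow> (\<exists>i::int. pi * x = of_int i * pi)"
    by (simp add: sin_zero_iff_int2)
  also have "\<dots> \<longleftrightarrow> x \<in> \<int>"
    by (auto simp: Ints_def)
  finally show ?thesis .
qed

lemma fejer_kernel_add_int: "fejer_kernel m (x + of_int k) = fejer_kernel m x"
proof -
  have s: "(sin (t + pi * of_int j))\<^sup>2 = (sin t)\<^sup>2" for t :: real and j :: int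
  proof -
    have "sin (pi * of_int j) = 0"
      by (simp add: sin_pi_eq_0_iff_Ints)
    moreover from this have "(cos (pi * of_int j))\<^sup>2 = 1"
      using sin_cos_squared_add[of "pi * of_int j"] by simp
    ultimately show ?thesis
      by (simp add: sin_add power_mult_distrib)
  qed
  have "(sin (pi * real m * (x + of_int k)))\<^sup>2 = (sin (pi * real m * x))\<^sup>2"
    using s[of "pi * real m * x" "int m * k"] by (simp add: algebra_simps)
  moreover have "(sin (pi * (x + of_int k)))\<^sup>2 = (sin (pi * x))\<^sup>2"
    using s[of "pi * x" k] by (simp add: algebra_simps)
  moreover have "x + of_int k \<in> \<int> \<longleftrightarrow> x \<in> \<int>"
    by (metis Ints_add Ints_diff Ints_of_int add_diff_cancel_right')
  ultimately show ?thesis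
    by (simp add: fejer_kernel_def power_divide)
qed

lemma isCont_fejer_kernel:
  assumes "m \<ge> 1"
  shows "isCont (fejer_kernel m) x"
proof -
  let ?q = "\<lambda>y::real. 1 / real m * (sin (pi * real m * y) / sin (pi * y))\<^sup>2"
  have at0: "isCont (fejer_kernel m) 0"
  proof -
    have m: "real m > 0" using assms by simp
    have lim: "((\<lambda>y::real. 1 / c * (sin (pi * c * y) / sin (pi * y))\<^sup>2) \<longlongrightarrow> c) (at 0)"
      if "c > 0" for c :: real
    proof -
      have "(pi * c * inverse pi)\<^sup>2 / c = c"
        using that by (simp add: power2_eq_square)
      with that show ?thesis by real_asymp
    qed
    have ev: "\<forall>\<^sub>F y in at 0. ?q y = fejer_kernel m y"
    proof -
      have "\<forall>\<^sub>F y::real in at 0. y \<in> {-1<..<1}"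
        by (rule eventually_at_in_open') auto
      moreover have "\<forall>\<^sub>F y::real in at 0. y \<noteq> 0"
        by (simp add: eventually_at_filter)
      ultimately show ?thesis
        by eventually_elim (auto simp: fejer_kernel_def elim!: Ints_cases)
    qed
    have "fejer_kernel m \<midarrow>0\<rightarrow> real m"
      using Lim_transform_eventually[OF lim[OF m] ev] .
    then show ?thesis
      by (simp add: isCont_def fejer_kernel_def)
  qed
  show ?thesis
  proof (cases "x \<in> \<int>")
    case True
    then obtain k where k: "x = of_int k" by (auto elim: Ints_cases)
    have "isCont (\<lambda>y. fejer_kernel m (y - of_int k)) x"
      by (rule isCont_o2[where g = "fejer_kernel m"]) (simp_all add: k at0)
    moreover have "fejer_kernel m (y - of_int k) = fejer_kernel m y" for y
      using fejer_kernel_add_int[of m y "- k"] by simp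
    ultimately show ?thesis by simp
  next
    case False
    have "\<forall>\<^sub>F y in nhds x. y \<in> - \<int>"
      by (rule eventually_nhds_in_open) (use False in \<open>simp_all add: open_Compl\<close>)
    then have ev: "\<forall>\<^sub>F y in nhds x. fejer_kernel m y = ?q y"
      by eventually_elim (simp add: fejer_kernel_def)
    have "isCont ?q x"
      using False assms by (intro continuous_intros) (auto simp: sin_pi_eq_0_iff_Ints)
    then show ?thesis
      using isCont_cong[OF ev] by simp
  qed
qed

end

theory Submission
  imports Defs
begin

text \<open>
  Since \<open>sin\<^sup>2 (2 * y) - sin\<^sup>2 y = sin\<^sup>2 y * (1 + 2 * cos (2 * y))\<close>, the de la Vallee Poussin
  kernel factors as \<open>V x = F x * D (N * x)\<close>, where \<open>F = fejer_kernel N\<close> and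
  \<open>D u = 1 + 2 * cos (2 * pi * u)\<close> is the Dirichlet kernel of order one for period \<open>1\<close>
  (\<open>vp_kernel_eq_fejer_times_dirichlet\<close>).  As \<open>F\<close> is nonnegative, \<open>\<bar>V x\<bar> = F x * g (N * x)\<close> for
  the 1-periodic function \<open>g u = \<bar>D u\<bar>\<close>.

  The dependence on \<open>N\<close> now disappears, because \<open>F x\<close> integrates against every function
  \<open>g (N * x)\<close> with \<open>g\<close> of period \<open>1\<close> as if it were the constant \<open>1\<close>
  (\<open>has_integral_fejer_kernel_times_periodic\<close>).  In terms of Fourier series, \<open>g (N * x)\<close> has only
  frequencies divisible by \<open>N\<close>, whereas the only such frequency in \<open>F\<close> is \<open>0\<close>, with
  coefficient \<open>1\<close>.  The proof uses the equivalent fact that the values of \<open>F\<close> at \<open>N\<close> equidistant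
  points have mean \<open>1\<close> (\<open>sum_fejer_kernel_equidistant\<close>): cutting \<open>[0, 1]\<close> into \<open>N\<close> equal
  intervals and rescaling each of them to \<open>[0, 1]\<close> produces exactly this mean as the weight of
  \<open>g\<close>.

  Hence the norm of \<open>V\<close> is the integral of \<open>\<bar>D\<bar>\<close> over a period, which is the first Lebesgue
  constant because \<open>sin (3 * t / 2) = sin (t / 2) * (1 + 2 * cos t)\<close>.  Its value comes from the
  antiderivative \<open>t + 2 * sin t\<close>, with sign changes at \<open>2 * pi / 3\<close> and \<open>4 * pi / 3\<close>.
\<close>

section \<open>Averaging against the Fejer kernel\<close>

text \<open>
  The geometric sum, together with \<open>\<bar>exp (\<i> * t) - 1\<bar> = 2 * \<bar>sin (t / 2)\<bar>\<close>.  As the square of an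
  exponential sum the kernel is accessible to orthogonality, and the integers are no longer
  exceptional.
\<close>

lemma fejer_kernel_eq_norm_sum:
  assumes "N \<ge> 1"
  shows "fejer_kernel N x = (cmod (\<Sum>j<N. cis (2 * pi * real j * x)))\<^sup>2 / real N"
proof (cases "x \<in> \<int>")
  case True
  have "cis (2 * pi * real j * x) = 1" for j
    using cis_multiple_2pi[of "real j * x"] True by (simp add: mult.assoc)
  then show ?thesis
    using True assms by (simp add: fejer_kernel_def power2_eq_square)
next
  case False
  let ?w = "cis (2 * pi * x)"
  have dist_1: "cmod (cis t - 1) = 2 * \<bar>sin (t / 2)\<bar>" for t
    using dist_exp_i_1[of t] by (simp add: cis_conv_exp)
  have ne: "sin (pi * x) \<noteq> 0"
    using False by (simp add: sin_pi_eq_0_iff_Ints)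
  have w: "?w \<noteq> 1"
    using dist_1[of "2 * pi * x"] ne by auto
  have "(\<Sum>j<N. cis (2 * pi * real j * x)) = (\<Sum>j<N. ?w ^ j)"
    by (simp add: Complex.DeMoivre mult_ac)
  also have "\<dots> = (?w ^ N - 1) / (?w - 1)"
    using w by (rule geometric_sum)
  also have "?w ^ N = cis (2 * pi * real N * x)"
    by (simp add: Complex.DeMoivre mult_ac)
  also have "cmod ((cis (2 * pi * real N * x) - 1) / (?w - 1)) =
      \<bar>sin (pi * real N * x) / sin (pi * x)\<bar>"
    by (simp add: norm_divide dist_1 mult.assoc)
  finally show ?thesis
    using False by (simp add: fejer_kernel_def power_divide)
qed

text \<open>
  Orthogonality of the characters of the cyclic group of order \<open>N\<close>: for \<open>j \<noteq> l\<close> this is a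
  geometric sum whose ratio is an \<open>N\<close>-th root of unity other than \<open>1\<close>, since
  \<open>0 < \<bar>j - l\<bar> < N\<close>.
\<close>

lemma sum_cis_roots_of_unity:
  assumes "j < N" "l < N"
  shows "(\<Sum>k<N. cis (2 * pi * (real j - real l) * real k / real N))
         = (if j = l then of_nat N else 0)"
proof (cases "j = l")
  case True
  then show ?thesis by simp
next
  case False
  let ?w = "cis (2 * pi * ((real j - real l) / real N))"
  have N: "real N > 0" using assms by simp
  have "?w \<noteq> 1"
  proof
    assume "?w = 1"
    then have "cos (2 * pi * ((real j - real l) / real N)) = 1"
      by (simp add: complex_eq_iff)
    then obtain i :: int where "2 * pi * ((real j - real l) / real N) = real_of_int i * 2 * pi"
      using cos_one_2pi_int by blast
    then have "2 * pi * (real j - real l) = 2 * pi * (real_of_int i * real N)"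
      using N by (simp add: divide_eq_eq mult_ac)
    then have "real j - real l = real_of_int i * real N"
      by (simp only: mult_cancel_left) simp
    then have "real_of_int (int j - int l) = real_of_int (i * int N)" by simp
    then have eq: "int j - int l = i * int N" using of_int_eq_iff by blast
    then have "int N dvd int j - int l" by simp
    moreover have "\<bar>int j - int l\<bar> < int N" using assms by auto
    ultimately show False
      using False dvd_imp_le_int[of "int j - int l" "int N"] by auto
  qed
  moreover have "?w ^ N = 1"
    using N cis_multiple_2pi[of "real j - real l"] by (simp add: Complex.DeMoivre)
  ultimately have "(\<Sum>k<N. ?w ^ k) = 0"
    by (simp add: geometric_sum)
  moreover have "(\<Sum>k<N. cis (2 * pi * (real j - real l) * real k / real N)) = (\<Sum>k<N. ?w ^ k)"
    by (intro sum.cong refl) (simp add: Complex.DeMoivre mult_ac)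
  ultimately show ?thesis using False by simp
qed

text \<open>
  Parseval's identity for the finite Fourier transform of length \<open>N\<close>: up to the factor \<open>1 / N\<close>, the
  kernel at \<open>(u + k) / N\<close> is the squared modulus of the \<open>k\<close>-th transform value of the unimodular
  vector with entries \<open>cis (2 * pi * j * u / N)\<close>, \<open>j < N\<close>.
\<close>

lemma sum_fejer_kernel_equidistant:
  assumes "N \<ge> 1"
  shows "(\<Sum>k<N. fejer_kernel N ((u + real k) / real N)) = real N"
proof -
  let ?e = "\<lambda>j k. cis (2 * pi * real j * ((u + real k) / real N))"
  have N: "real N > 0" using assms by simp
  have prod: "?e j k * cnj (?e l k)
      = cis (2 * pi * (real j - real l) * u / real N)
        * cis (2 * pi * (real j - real l) * real k / real N)" for j l k
    using N by (simp add: cis_cnj cis_mult flip: add_divide_distrib)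
      (simp add: algebra_simps add_divide_distrib diff_divide_distrib)
  have "complex_of_real (\<Sum>k<N. (cmod (\<Sum>j<N. ?e j k))\<^sup>2)
      = (\<Sum>k<N. \<Sum>j<N. \<Sum>l<N. ?e j k * cnj (?e l k))"
    by (simp only: of_real_sum complex_norm_square cnj_sum sum_product)
  also have "\<dots> = (\<Sum>j<N. \<Sum>k<N. \<Sum>l<N. ?e j k * cnj (?e l k))"
    by (rule sum.swap)
  also have "\<dots> = (\<Sum>j<N. \<Sum>l<N. \<Sum>k<N. ?e j k * cnj (?e l k))"
    by (intro sum.cong refl sum.swap)
  also have "\<dots> = (\<Sum>j<N. \<Sum>l<N. if j = l then of_nat N else 0)"
  proof (intro sum.cong refl)
    fix j l assume "j \<in> {..<N}" "l \<in> {..<N}"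
    then show "(\<Sum>k<N. ?e j k * cnj (?e l k)) = (if j = l then of_nat N else 0)"
      unfolding prod sum_distrib_left[symmetric]
      by (simp add: sum_cis_roots_of_unity del: times_divide_eq_right)
  qed
  also have "\<dots> = complex_of_real (real N * real N)"
    by simp
  finally have "(\<Sum>k<N. (cmod (\<Sum>j<N. ?e j k))\<^sup>2) = real N * real N"
    using of_real_eq_iff by blast
  then show ?thesis
    using N assms by (simp add: fejer_kernel_eq_norm_sum flip: sum_divide_distrib)
qed

lemma has_integral_split_equidistant:
  fixes f :: "real \<Rightarrow> real"
  assumes "N \<ge> 1"
    and pieces: "\<And>k. k < N \<Longrightarrow> ((\<lambda>u. f ((u + real k) / real N)) has_integral I k) {0..1}"
  shows "(f has_integral (\<Sum>k<N. I k) / real N) {0..1}"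
proof -
  have N: "real N > 0" using assms by simp
  have piece: "(f has_integral I k / real N) {real k / real N..real (Suc k) / real N}"
    if "k < N" for k
    using has_integral_affinity'[of "\<lambda>u. f ((u + real k) / real N)" "I k" 0 1 "real N" "- real k"]
      pieces[OF that] N
    by (simp add: field_simps)
  have "(f has_integral (\<Sum>k<n. I k) / real N) {0..real n / real N}" if "n \<le> N" for n
    using that
  proof (induction n)
    case 0
    then show ?case by (simp add: has_integral_refl)
  next
    case (Suc n)
    then have "(f has_integral (\<Sum>k<n. I k) / real N + I n / real N) {0..real (Suc n) / real N}"
      using N by (intro has_integral_combine[OF _ _ _ piece]) (auto simp: divide_right_mono)
    then show ?case by (simp add: add_divide_distrib)
  qed
  from this[of N] show ?thesis using N by simp
qed

text \<open>
  After splitting and rescaling, periodicity turns every factor \<open>g (N * x)\<close> into the same \<open>g u\<close>, so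
  that only the sum of the kernel values at \<open>(u + k) / N\<close> remains as its weight; this sum is \<open>N\<close>
  and cancels the factor \<open>1 / N\<close> from the rescaling.
\<close>

lemma has_integral_fejer_kernel_times_periodic:
  fixes g :: "real \<Rightarrow> real"
  assumes N: "N \<ge> 1"
    and cont: "continuous_on {0..1} g"
    and periodic: "\<And>u. g (u + 1) = g u"
  shows "((\<lambda>x. fejer_kernel N x * g (real N * x)) has_integral integral {0..1} g) {0..1}"
proof -
  have shift: "g (u + real k) = g u" for u k
    using periodic[of "u + real k" for k] by (induction k) (simp_all add: add_ac)
  let ?h = "\<lambda>k u. fejer_kernel N ((u + real k) / real N) * g u"
  have integrable: "?h k integrable_on {0..1}" for k
    using N cont
    by (intro integrable_continuous_interval continuous_on_mult
        continuous_on_compose2[OF continuous_at_imp_continuous_on[of UNIV "fejer_kernel N"]]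
        continuous_intros) (auto simp: isCont_fejer_kernel)
  have "((\<lambda>u. \<Sum>k<N. ?h k u) has_integral (\<Sum>k<N. integral {0..1} (?h k))) {0..1}"
    using integrable by (intro has_integral_sum integrable_integral) auto
  moreover have "(\<lambda>u. \<Sum>k<N. ?h k u) = (\<lambda>u. real N * g u)"
    by (simp add: sum_fejer_kernel_equidistant[OF N] flip: sum_distrib_right)
  ultimately have "((\<lambda>u. real N * g u) has_integral (\<Sum>k<N. integral {0..1} (?h k))) {0..1}"
    by (simp only:)
  then have "(\<Sum>k<N. integral {0..1} (?h k)) = integral {0..1} (\<lambda>u. real N * g u)"
    by (rule integral_unique[symmetric])
  also have "\<dots> = real N * integral {0..1} g"
    by (rule integral_mult_right)
  finally have sum_pieces: "(\<Sum>k<N. integral {0..1} (?h k)) = real N * integral {0..1} g" .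
  have "((\<lambda>x. fejer_kernel N x * g (real N * x)) has_integral
      (\<Sum>k<N. integral {0..1} (?h k)) / real N) {0..1}"
  proof (rule has_integral_split_equidistant[OF N])
    fix k assume "k < N"
    have "(\<lambda>u. fejer_kernel N ((u + real k) / real N) * g (real N * ((u + real k) / real N))) = ?h k"
      using N shift by simp
    then show "((\<lambda>u. fejer_kernel N ((u + real k) / real N) * g (real N * ((u + real k) / real N)))
        has_integral integral {0..1} (?h k)) {0..1}"
      using integrable by (simp only: integrable_integral)
  qed
  then show ?thesis using N by (simp add: sum_pieces)
qed

section \<open>Factoring out the Dirichlet kernel\<close>

lemma sin_times_3:
  fixes t :: real
  shows "sin (3 * t) = sin t * (1 + 2 * cos (2 * t))"
proof -
  have "sin (3 * t) = sin (t + 2 * t)" by simp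
  also have "\<dots> = sin t * (1 + 2 * cos (2 * t))"
    unfolding sin_add cos_double_cos sin_double by (simp add: algebra_simps power2_eq_square)
  finally show ?thesis .
qed

lemma vp_kernel_eq_fejer_times_dirichlet:
  assumes "N \<ge> 1"
  shows "vp_kernel N x = fejer_kernel N x * (1 + 2 * cos (2 * pi * (real N * x)))"
proof (cases "x \<in> \<int>")
  case True
  then have "cis (2 * pi * (real N * x)) = 1"
    by (intro cis_multiple_2pi) auto
  then have "cos (2 * pi * (real N * x)) = 1"
    by (metis cis.sel(1) one_complex.sel(1))
  then show ?thesis
    using True by (simp add: vp_kernel_def fejer_kernel_def)
next
  case False
  let ?y = "pi * real N * x"
  have "(sin (2 * ?y))\<^sup>2 - (sin ?y)\<^sup>2 = (sin ?y)\<^sup>2 * (4 * (cos ?y)\<^sup>2 - 1)"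
    unfolding sin_double by (simp add: algebra_simps power2_eq_square)
  also have "4 * (cos ?y)\<^sup>2 - 1 = 1 + 2 * cos (2 * ?y)"
    unfolding cos_double_cos by simp
  finally have "(sin (2 * ?y))\<^sup>2 - (sin ?y)\<^sup>2 = (sin ?y)\<^sup>2 * (1 + 2 * cos (2 * ?y))" .
  moreover have "vp_kernel N x = ((sin (2 * ?y))\<^sup>2 - (sin ?y)\<^sup>2) / (real N * (sin (pi * x))\<^sup>2)"
    using False assms
    by (simp add: vp_kernel_def fejer_kernel_def power_divide diff_divide_distrib mult_ac)
  ultimately show ?thesis
    using False by (simp add: fejer_kernel_def power_divide mult_ac)
qed

lemma fejer_kernel_nonneg: "fejer_kernel N x \<ge> 0"
  by (simp add: fejer_kernel_def)

section \<open>The first Lebesgue constant\<close>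

lemma has_integral_abs_dirichlet_1:
  "((\<lambda>t::real. \<bar>1 + 2 * cos t\<bar>) has_integral 2 * pi / 3 + 4 * sqrt 3) {0..2 * pi}"
proof -
  let ?G = "\<lambda>t::real. t + 2 * sin t"
  have G: "(?G has_vector_derivative 1 + 2 * cos t) (at t within S)" for t S
    unfolding has_real_derivative_iff_has_vector_derivative[symmetric]
    by (auto intro!: derivative_eq_intros)
  have FTC: "((\<lambda>t. 1 + 2 * cos t) has_integral ?G b - ?G a) {a..b}" if "a \<le> b" for a b
    using that G by (rule fundamental_theorem_of_calculus)
  have cos_reflect: "cos (2 * pi - t) = cos t" for t :: real
    by (simp add: cos_diff)
  have pos_left: "1 + 2 * cos t \<ge> 0" if "0 \<le> t" "t \<le> 2 * pi / 3" for t :: real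
    using cos_monotone_0_pi_le[of t "2 * pi / 3"] that by (simp add: cos_120)
  have neg_left: "1 + 2 * cos t \<le> 0" if "2 * pi / 3 \<le> t" "t \<le> pi" for t :: real
    using cos_monotone_0_pi_le[of "2 * pi / 3" t] that by (simp add: cos_120)
  \<comment> \<open>The graph of the cosine is symmetric about \<open>pi\<close>, so the signs beyond \<open>pi\<close> follow by reflection.\<close>
  have neg: "1 + 2 * cos t \<le> 0" if "2 * pi / 3 \<le> t" "t \<le> 4 * pi / 3" for t :: real
    using neg_left[of t] neg_left[of "2 * pi - t"] that by (cases "t \<le> pi") (auto simp: cos_reflect)
  have pos_right: "1 + 2 * cos t \<ge> 0" if "4 * pi / 3 \<le> t" "t \<le> 2 * pi" for t :: real
    using pos_left[of "2 * pi - t"] that by (simp add: cos_reflect)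
  have sin_240: "sin (4 * pi / 3) = - sqrt 3 / 2"
    using sin_periodic_pi[of "pi / 3"] by (simp add: sin_60 add_divide_distrib field_simps)
  have left: "((\<lambda>t. \<bar>1 + 2 * cos t\<bar>) has_integral 2 * pi / 3 + sqrt 3) {0..2 * pi / 3}"
    using FTC[of 0 "2 * pi / 3"] pos_left
    by (subst has_integral_cong[where g = "\<lambda>t. 1 + 2 * cos t"]) (auto simp: sin_120)
  have mid: "((\<lambda>t. \<bar>1 + 2 * cos t\<bar>) has_integral 2 * sqrt 3 - 2 * pi / 3)
      {2 * pi / 3..4 * pi / 3}"
    using has_integral_neg[OF FTC[of "2 * pi / 3" "4 * pi / 3"]] neg
    by (subst has_integral_cong[where g = "\<lambda>t. - (1 + 2 * cos t)"])
       (auto simp: sin_120 sin_240 abs_of_nonpos)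
  have right: "((\<lambda>t. \<bar>1 + 2 * cos t\<bar>) has_integral 2 * pi / 3 + sqrt 3) {4 * pi / 3..2 * pi}"
    using FTC[of "4 * pi / 3" "2 * pi"] pos_right
    by (subst has_integral_cong[where g = "\<lambda>t. 1 + 2 * cos t"]) (auto simp: sin_240)
  have "((\<lambda>t. \<bar>1 + 2 * cos t\<bar>) has_integral
      (2 * pi / 3 + sqrt 3) + (2 * sqrt 3 - 2 * pi / 3) + (2 * pi / 3 + sqrt 3)) {0..2 * pi}"
    by (rule has_integral_combine[OF _ _ has_integral_combine[OF _ _ left mid] right]) auto
  then show ?thesis by (simp add: algebra_simps)
qed

lemma lebesgue_const_1: "lebesgue_const 1 = 1 / 3 + 2 * sqrt 3 / pi"
proof -
  have "((\<lambda>t. \<bar>sin ((real 1 + 1 / 2) * t) / sin (t / 2)\<bar>) has_integral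
      2 * pi / 3 + 4 * sqrt 3) {0..2 * pi}"
  proof (rule has_integral_spike_finite[OF _ _ has_integral_abs_dirichlet_1])
    fix t :: real assume "t \<in> {0..2 * pi} - {0, 2 * pi}"
    then have "sin (t / 2) > 0" by (intro sin_gt_zero) auto
    then show "\<bar>sin ((real 1 + 1 / 2) * t) / sin (t / 2)\<bar> = \<bar>1 + 2 * cos t\<bar>"
      using sin_times_3[of "t / 2"] by simp
  qed simp
  then show ?thesis
    by (simp add: lebesgue_const_def integral_unique field_simps)
qed

text \<open>
  The margins to the two bounds are about \<open>4 / 10 ^ 9\<close> and \<open>6 / 10 ^ 9\<close>, so nine decimals of
  \<open>sqrt 3\<close> and of \<open>pi\<close> suffice.
\<close>

lemma lebesgue_const_1_bounds:
  "1.43599112 \<le> 1 / 3 + 2 * sqrt 3 / pi" "1 / 3 + 2 * sqrt 3 / pi < 1.43599113"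
proof -
  have sqrt_3: "1.732050807 \<le> sqrt 3" "sqrt 3 \<le> 1.732050808"
    by (intro real_le_rsqrt real_le_lsqrt; simp add: power2_eq_square)+
  have "(1.43599112 - 1 / 3) * pi \<le> 2 * sqrt 3" "2 * sqrt 3 < (1.43599113 - 1 / 3) * pi"
    using sqrt_3 pi_approx by auto
  then show "1.43599112 \<le> 1 / 3 + 2 * sqrt 3 / pi" "1 / 3 + 2 * sqrt 3 / pi < 1.43599113"
    by (simp_all add: field_simps)
qed

lemma integral_abs_dirichlet_1_period_1:
  "integral {0..1} (\<lambda>u. \<bar>1 + 2 * cos (2 * pi * u)\<bar>) = 1 / 3 + 2 * sqrt 3 / pi"
proof (rule integral_unique)
  have "((\<lambda>u. \<bar>1 + 2 * cos (2 * pi * u)\<bar>) has_integral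
      (1 / \<bar>2 * pi\<bar>) *\<^sub>R (2 * pi / 3 + 4 * sqrt 3)) ((\<lambda>x. x / (2 * pi)) ` {0..2 * pi})"
    by (rule has_integral_stretch_real[OF has_integral_abs_dirichlet_1]) simp
  moreover have "(\<lambda>x. x / (2 * pi)) ` {0..2 * pi} = {0..1}"
    by simp
  moreover have "(1 / \<bar>2 * pi\<bar>) *\<^sub>R (2 * pi / 3 + 4 * sqrt 3) = 1 / 3 + 2 * sqrt 3 / pi"
    by (simp add: add_divide_distrib)
  ultimately show "((\<lambda>u. \<bar>1 + 2 * cos (2 * pi * u)\<bar>) has_integral 1 / 3 + 2 * sqrt 3 / pi) {0..1}"
    by (simp only:)
qed

theorem corollary1p3:
  fixes N :: nat
  assumes "N \<ge> 1"
  shows "integral {0..1} (\<lambda>x. \<bar>vp_kernel N x\<bar>) = lebesgue_const 1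
    \<and> lebesgue_const 1 = 1 / 3 + 2 * sqrt 3 / pi
    \<and> 1.43599112 \<le> lebesgue_const 1 \<and> lebesgue_const 1 < 1.43599113"
proof -
  let ?g = "\<lambda>u. \<bar>1 + 2 * cos (2 * pi * u)\<bar>"
  have "(\<lambda>x. \<bar>vp_kernel N x\<bar>) = (\<lambda>x. fejer_kernel N x * ?g (real N * x))"
    using assms
    by (simp add: vp_kernel_eq_fejer_times_dirichlet abs_mult fejer_kernel_nonneg)
  moreover have "((\<lambda>x. fejer_kernel N x * ?g (real N * x)) has_integral integral {0..1} ?g) {0..1}"
    using assms
    by (intro has_integral_fejer_kernel_times_periodic[where g = ?g] continuous_intros)
       (simp_all add: distrib_left)
  ultimately have "integral {0..1} (\<lambda>x. \<bar>vp_kernel N x\<bar>) = integral {0..1} ?g"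
    by (simp add: integral_unique)
  then show ?thesis
    using lebesgue_const_1_bounds
    by (simp only: integral_abs_dirichlet_1_period_1 lebesgue_const_1)
qed

end
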